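(* Let $(a_n)_{n\ge1}$ and $(b_n)_{n\ge1}$ be sequences of positive integers and let $\tau$ be the value of the generalized continued fraction \[ \tau=\cfrac{a_1}{b_1+\cfrac{a_2}{b_2+\cdots}}. \] Suppose \[ a_n\le\alpha n^{l},\qquad \beta_1 n^{k_1}\le b_n\le \beta_2 n^{k_2} \] for all $n\in\mathbb{Z}^+$, where $\alpha$ is a real number, $l$ is a non-negative real number and $\beta_1,\beta_2,k_1,k_2$ are positive real numbers satisfying \[ l<k_1\le k_2 . \] Then $\tau$ is irrational and \[ \mu_I(\tau)\le 2+\frac{l}{k_1-l}. \]
   Context: The value of the generalized continued fraction is the limit $\lim_{n\to\infty}A_n/B_n$ of its convergents, where $A_0=0$, $B_0=1$, $A_1=a_1$, $B_1=b_1$ and $A_{n+2}=b_{n+2}A_{n+1}+a_{n+2}A_n$, $B_{n+2}=b_{n+2}B_{n+1}+a_{n+2}B_n$ for $n\ge 0$ (such a limit need not exist in general, but it does in all instances considered here). For a real number $\tau$, an irrationality exponent of $\tau$ is any $\mu$ for which there exist positive constants $c$ and $N_0$ such that $\left|\tau-\frac{M}{N}\right|\ge \frac{c}{N^{\mu}}$ for all $M,N\in\mathbb{Z}$ with $N\ge N_0$. The asymptotic irrationality exponent $\mu_I(\tau)$ is the infimum of all irrationality exponents $\mu$ of $\tau$, where the infimum of the empty set is $\infty$. *)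

theory Defs
  imports "HOL-Analysis.Analysis"
begin

text \<open>
  The generalized continued fraction a 1 / (b 1 + a 2 / (b 2 + ...)) has the convergents
  \<open>gcf_num a b n / gcf_denom a b n\<close>.  The entries \<open>a 0\<close> and \<open>b 0\<close> are never used.
\<close>

fun gcf_num :: "(nat \<Rightarrow> int) \<Rightarrow> (nat \<Rightarrow> int) \<Rightarrow> nat \<Rightarrow> int" where
  "gcf_num a b 0 = 0"
| "gcf_num a b (Suc 0) = a 1"
| "gcf_num a b (Suc (Suc n)) =
     b (n + 2) * gcf_num a b (Suc n) + a (n + 2) * gcf_num a b n"

fun gcf_denom :: "(nat \<Rightarrow> int) \<Rightarrow> (nat \<Rightarrow> int) \<Rightarrow> nat \<Rightarrow> int" where
  "gcf_denom a b 0 = 1"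
| "gcf_denom a b (Suc 0) = b 1"
| "gcf_denom a b (Suc (Suc n)) =
     b (n + 2) * gcf_denom a b (Suc n) + a (n + 2) * gcf_denom a b n"

definition gcf_convergent :: "(nat \<Rightarrow> int) \<Rightarrow> (nat \<Rightarrow> int) \<Rightarrow> nat \<Rightarrow> real" where
  "gcf_convergent a b n = real_of_int (gcf_num a b n) / real_of_int (gcf_denom a b n)"

text \<open>Meaningful only if the sequence of convergents has a limit.\<close>

definition gcf_value :: "(nat \<Rightarrow> int) \<Rightarrow> (nat \<Rightarrow> int) \<Rightarrow> real" where
  "gcf_value a b = lim (gcf_convergent a b)"

definition irrationality_exponent :: "real \<Rightarrow> real \<Rightarrow> bool" where
  "irrationality_exponent \<tau> \<mu> \<longleftrightarrow>
     (\<exists>c>0. \<exists>N\<^sub>0>0. \<forall>M N :: int. real_of_int N \<ge> N\<^sub>0 \<longrightarrow>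
        \<bar>\<tau> - real_of_int M / real_of_int N\<bar> \<ge> c / real_of_int N powr \<mu>)"

text \<open>The infimum is taken in the extended reals, so that it is \<open>\<infinity>\<close> on the empty set.\<close>

definition asymp_irrationality_exponent :: "real \<Rightarrow> ereal" where
  "asymp_irrationality_exponent \<tau> = Inf {ereal \<mu> | \<mu>. irrationality_exponent \<tau> \<mu>}"

end

theory Submission
  imports Defs
begin

text \<open>
  Write \<open>A n / B n\<close> for the convergents and \<open>P n = a 1 \<cdots> a n\<close>.  The determinant
  identity \<open>A (n+1) B n - A n B (n+1) = (-1)^n P (n+1)\<close> turns the convergents into the
  partial sums of an alternating series with decreasing terms, so they converge to \<open>\<tau>\<close> and
  \<open>\<bar>B n \<tau> - A n\<bar> \<le> P (n+1) / B (n+1)\<close>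
  (\<open>convergents\<close>), as soon as \<open>P n / B n\<close> tends to \<open>0\<close>.  It does: \<open>P n\<close> is at most
  \<open>\<alpha>^n (n!)^l\<close>, and \<open>B n\<close> is at least \<open>b 1 \<cdots> b n\<close>, hence at least
  \<open>\<beta>\<^sub>1^n (n!)^k\<^sub>1\<close>; as \<open>l < k\<^sub>1\<close>, the factorials win over the exponential factors.

  A fraction \<open>M / N\<close> is compared with a convergent for which \<open>N A n - M B n\<close> is a nonzero
  integer; since the determinant does not vanish, one of any two consecutive convergents
  qualifies.  Let \<open>m\<close> be the last index with \<open>B m < 2 N P m\<close>.  From \<open>m\<close> on, the error
  \<open>N \<bar>B n \<tau> - A n\<bar>\<close> is at most \<open>1/2\<close>, which forces
  \<open>\<bar>\<tau> - M / N\<bar> \<ge> 1 / (2 N B (m+1))\<close> (\<open>rational_distance_ge\<close>).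

  It remains to bound \<open>B (m+1)\<close> by a power of \<open>N\<close>.  One step of the recurrence costs a
  factor polynomial in \<open>m\<close>, and \<open>B m < 2 N P m\<close>.  This last inequality also gives
  \<open>(m!)^(k\<^sub>1-l) \<le> (\<alpha>/\<beta>\<^sub>1)^m 2 N\<close>, so that, up to a factor exponential in \<open>m\<close>,
  \<open>P m \<le> (m!)^l \<le> (2 N)^(l/(k\<^sub>1-l))\<close>.  By the same inequality all polynomial and
  exponential factors in \<open>m\<close> are \<open>O(N^\<epsilon>)\<close>.  Altogether \<open>N B (m+1)\<close> is
  \<open>O(N^(2 + l/(k\<^sub>1-l) + \<epsilon>))\<close>, for every \<open>\<epsilon> > 0\<close>.  Irrationality is a consequence,
  because a rational number has no irrationality exponent at all.
\<close>

section \<open>Factorial growth\<close>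

text \<open>The term \<open>x^n / n!\<close> of the exponential series is at most \<open>exp x\<close>; take
  \<open>x = H powr (1 / \<sigma>)\<close> and raise to the power \<open>\<sigma>\<close>.\<close>

lemma power_le_factorial_powr:
  fixes H \<sigma> :: real
  assumes "H > 0" "\<sigma> > 0"
  shows "\<exists>C>0. \<forall>n. H ^ n \<le> C * fact n powr \<sigma>"
proof -
  define x where "x = H powr (1 / \<sigma>)"
  have x: "x > 0" "x powr \<sigma> = H"
    using assms by (simp_all add: x_def powr_powr)
  have "H ^ n \<le> exp x powr \<sigma> * fact n powr \<sigma>" for n
  proof -
    have "x ^ n / fact n = (\<Sum>k\<in>{n}. inverse (fact k) * x ^ k)"
      by (simp add: field_simps)
    also have "\<dots> \<le> (\<Sum>k. inverse (fact k) * x ^ k)"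
      using x by (intro sum_le_suminf summable_exp) auto
    also have "\<dots> = exp x"
      by (simp add: exp_def scaleR_conv_of_real)
    finally have "x ^ n \<le> exp x * fact n"
      by (simp add: field_simps)
    then have "(x ^ n) powr \<sigma> \<le> (exp x * fact n) powr \<sigma>"
      using assms x by (intro powr_mono2) auto
    moreover have "(x ^ n) powr \<sigma> = H ^ n"
      using x by (simp add: powr_realpow[symmetric] powr_powr mult.commute flip: x(2))
    ultimately show ?thesis
      by (simp add: powr_mult)
  qed
  then show ?thesis
    by (intro exI[of _ "exp x powr \<sigma>"]) auto
qed

text \<open>A polynomial factor is absorbed by the exponential one, as \<open>n + 1 \<le> exp n\<close>.\<close>

lemma poly_times_power_le_factorial_powr:
  fixes H K \<sigma> :: real
  assumes "H > 0" "\<sigma> > 0" "K \<ge> 0"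
  shows "\<exists>C>0. \<forall>n. (real n + 1) powr K * H ^ n \<le> C * fact n powr \<sigma>"
proof -
  obtain C where C: "C > 0" "\<And>n. (exp K * H) ^ n \<le> C * fact n powr \<sigma>"
    using power_le_factorial_powr[of "exp K * H" \<sigma>] assms by auto
  have "(real n + 1) powr K * H ^ n \<le> C * fact n powr \<sigma>" for n
  proof -
    have "(real n + 1) powr K \<le> exp (real n) powr K"
      using assms exp_ge_add_one_self[of "real n"] by (intro powr_mono2) (simp_all add: add.commute)
    also have "\<dots> = exp K ^ n"
      by (simp add: powr_def exp_of_nat_mult[symmetric] mult.commute)
    finally have "(real n + 1) powr K * H ^ n \<le> (exp K * H) ^ n"
      using assms by (simp add: power_mult_distrib)
    with C(2)[of n] show ?thesis
      by simp
  qed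
  with C(1) show ?thesis
    by blast
qed

lemma prod_powr_nat:
  "(\<Prod>i=1..n. c * real i powr e) = c ^ n * fact n powr e"
  by (induction n) (simp_all add: powr_mult mult_ac)

section \<open>Convergents of continued fractions with positive entries\<close>

locale positive_gcf =
  fixes a b :: "nat \<Rightarrow> int"
  assumes a_pos: "n \<ge> 1 \<Longrightarrow> a n > 0"
    and b_pos: "n \<ge> 1 \<Longrightarrow> b n > 0"
begin

abbreviation "A \<equiv> gcf_num a b"
abbreviation "B \<equiv> gcf_denom a b"
definition P :: "nat \<Rightarrow> int" where
  "P n = (\<Prod>i=1..n. a i)"

lemma P_0 [simp]: "P 0 = 1"
  by (simp add: P_def)

lemma P_Suc: "P (Suc n) = a (Suc n) * P n"
  by (simp add: P_def mult.commute)

lemma P_pos: "P n > 0"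
  unfolding P_def using a_pos by (intro prod_pos) auto

lemma B_pos: "B n > 0"
proof (induction n rule: induct_nat_012)
  case (ge2 n)
  then show ?case
    using a_pos[of "n + 2"] b_pos[of "n + 2"] by (simp add: add_pos_pos)
qed (use b_pos in auto)

lemma B_Suc_ge: "b (Suc n) * B n \<le> B (Suc n)"
proof (cases n)
  case (Suc m)
  then show ?thesis
    using a_pos[of "m + 2"] B_pos[of m] by simp
qed simp

lemma B_le_Suc: "B n \<le> B (Suc n)"
proof -
  have "1 * B n \<le> b (Suc n) * B n"
    using b_pos[of "Suc n"] B_pos[of n] by (intro mult_right_mono) auto
  with B_Suc_ge[of n] show ?thesis
    by linarith
qed

lemma B_Suc_le: "B (Suc n) \<le> (a (Suc n) + b (Suc n)) * B n"
proof (cases n)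
  case 0
  then show ?thesis using a_pos[of 1] by simp
next
  case (Suc m)
  then show ?thesis
    using mult_left_mono[OF B_le_Suc[of m], of "a (m + 2)"] a_pos[of "m + 2"]
    by (simp add: distrib_right)
qed

lemma B_ge_prod: "(\<Prod>i=1..n. b i) \<le> B n"
proof (induction n)
  case (Suc n)
  have "(\<Prod>i=1..Suc n. b i) = b (Suc n) * (\<Prod>i=1..n. b i)"
    by (simp add: mult.commute)
  also have "\<dots> \<le> b (Suc n) * B n"
    using Suc b_pos[of "Suc n"] by (intro mult_left_mono) auto
  also have "\<dots> \<le> B (Suc n)"
    by (rule B_Suc_ge)
  finally show ?case .
qed simp

lemma determinant: "A (Suc n) * B n - A n * B (Suc n) = (-1) ^ n * P (Suc n)"
proof (induction n)
  case (Suc n)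
  have "A (Suc (Suc n)) * B (Suc n) - A (Suc n) * B (Suc (Suc n))
      = - a (n + 2) * (A (Suc n) * B n - A n * B (Suc n))"
    by (simp add: algebra_simps)
  also have "\<dots> = (-1) ^ Suc n * P (Suc (Suc n))"
    unfolding Suc.IH by (simp add: P_Suc[of "Suc n"])
  finally show ?case .
qed (simp add: P_Suc)

text \<open>The distance between the convergents \<open>n\<close> and \<open>n + 1\<close>; see \<open>convergent_diff\<close>.\<close>

definition gap :: "nat \<Rightarrow> real" where
  "gap n = P (Suc n) / (B n * B (Suc n))"

lemma gap_pos: "gap n > 0"
  unfolding gap_def using P_pos[of "Suc n"] B_pos[of n] B_pos[of "Suc n"]
  by (intro divide_pos_pos) simp_all

lemma convergent_diff:
  "gcf_convergent a b (Suc n) - gcf_convergent a b n = (-1) ^ n * gap n"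
proof -
  have "gcf_convergent a b (Suc n) - gcf_convergent a b n
      = real_of_int (A (Suc n) * B n - A n * B (Suc n)) / (B n * B (Suc n))"
    using B_pos[of n] B_pos[of "Suc n"] unfolding gcf_convergent_def
    by (simp add: field_simps)
  also have "\<dots> = (-1) ^ n * gap n"
    unfolding determinant gap_def by simp
  finally show ?thesis .
qed

lemma convergent_eq_alternating_sum:
  "gcf_convergent a b n = (\<Sum>i<n. (-1) ^ i * gap i)"
proof (induction n)
  case 0
  then show ?case by (simp add: gcf_convergent_def)
next
  case (Suc n)
  then show ?case using convergent_diff[of n] by simp
qed

text \<open>The ratio of consecutive gaps is \<open>a (n+2) * B n / B (n+2)\<close>, and the numerator is one of
  the two nonnegative summands of \<open>B (n+2)\<close>.  Hence the gaps decrease for all positive entries,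
  and the Leibniz criterion needs only that they tend to \<open>0\<close>.\<close>

lemma gap_Suc_le: "gap (Suc n) \<le> gap n"
proof -
  have "a (n + 2) * B n \<le> B (Suc (Suc n))"
    using b_pos[of "n + 2"] B_pos[of "Suc n"] by simp
  then have le: "real_of_int (a (n + 2)) * B n \<le> B (Suc (Suc n))"
    by (metis of_int_le_iff of_int_mult)
  have "gap (Suc n) = gap n * (a (n + 2) * B n / B (Suc (Suc n)))"
    using B_pos[of n] B_pos[of "Suc n"] B_pos[of "Suc (Suc n)"]
    unfolding gap_def P_Suc[of "Suc n"] by (simp add: field_simps del: gcf_denom.simps)
  also have "\<dots> \<le> gap n * 1"
    using le gap_pos[of n] B_pos[of "Suc (Suc n)"]
    by (intro mult_left_mono) (simp_all del: gcf_denom.simps)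
  finally show ?thesis by simp
qed

lemma gap_le: "gap n \<le> P (Suc n) / B (Suc n)"
  unfolding gap_def using P_pos[of "Suc n"] B_pos[of n] B_pos[of "Suc n"]
  by (intro divide_left_mono) simp_all

text \<open>By the Leibniz criterion the value lies between any two consecutive convergents, so each
  error is at most the gap to the next one.\<close>

lemma convergents:
  assumes "(\<lambda>n. real_of_int (P n) / B n) \<longlonglongrightarrow> 0"
  shows convergents_tendsto: "gcf_convergent a b \<longlonglongrightarrow> gcf_value a b"
    and convergent_error: "\<bar>gcf_value a b - gcf_convergent a b n\<bar> \<le> gap n"
proof -
  have "(\<lambda>n. real_of_int (P (Suc n)) / B (Suc n)) \<longlonglongrightarrow> 0"
    using assms by (rule LIMSEQ_Suc)
  then have gap0: "gap \<longlonglongrightarrow> 0"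
    by (rule Lim_null_comparison[rotated])
       (use gap_pos gap_le in \<open>auto intro!: always_eventually simp: less_imp_le abs_of_pos\<close>)
  define S where "S = (\<Sum>i. (-1) ^ i * gap i)"
  have dec: "0 \<le> gap k" "gap (Suc k) \<le> gap k" for k
    using gap_pos[of k] gap_Suc_le[of k] by auto
  note leib = summable_Leibniz'[OF gap0 dec, folded S_def]
  have lim: "gcf_convergent a b \<longlonglongrightarrow> S"
    using leib(1) unfolding S_def convergent_eq_alternating_sum[abs_def]
    by (rule summable_LIMSEQ)
  then have S: "gcf_value a b = S"
    unfolding gcf_value_def by (rule limI)
  show "gcf_convergent a b \<longlonglongrightarrow> gcf_value a b"
    using lim S by simp
  have even: "gcf_convergent a b (2 * k) \<le> S" for k
    using leib(2)[of k] by (simp add: convergent_eq_alternating_sum)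
  have odd: "S \<le> gcf_convergent a b (Suc (2 * k))" for k
    using leib(4)[of k] by (simp add: convergent_eq_alternating_sum)
  show "\<bar>gcf_value a b - gcf_convergent a b n\<bar> \<le> gap n"
  proof (cases "even n")
    case True
    then obtain k where "n = 2 * k" by auto
    then show ?thesis
      using even[of k] odd[of k] convergent_diff[of n] S by simp
  next
    case False
    then obtain k where "n = Suc (2 * k)" by (auto elim: oddE)
    then show ?thesis
      using even[of "Suc k"] odd[of k] convergent_diff[of n] S by simp
  qed
qed

text \<open>Choose \<open>n\<close> among \<open>m\<close> and \<open>m + 1\<close> such that the integer \<open>D n = N * A n - M * B n\<close> is
  nonzero.  Then \<open>1 \<le> \<bar>D n\<bar> \<le> N * B n * gap n + N * B n * \<bar>\<tau> - M / N\<bar>\<close>, where \<open>small\<close>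
  makes the first summand at most \<open>1 / 2\<close>.\<close>

lemma rational_distance_ge:
  fixes M N :: int
  assumes lim: "(\<lambda>n. real_of_int (P n) / B n) \<longlonglongrightarrow> 0"
    and N: "N \<ge> 1"
    and small: "\<And>n. n > m \<Longrightarrow> 2 * N * P n \<le> B n"
  shows "1 / (2 * real_of_int N * B (Suc m)) \<le> \<bar>gcf_value a b - M / N\<bar>"
proof -
  define D where "D n = N * A n - M * B n" for n
  define \<tau> where "\<tau> = gcf_value a b"
  have "D m * B (Suc m) - D (Suc m) * B m = - N * (A (Suc m) * B m - A m * B (Suc m))"
    unfolding D_def by (simp add: algebra_simps)
  also have "\<dots> \<noteq> 0"
    unfolding determinant using N P_pos[of "Suc m"] by simp
  finally have "D m \<noteq> 0 \<or> D (Suc m) \<noteq> 0"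
    by auto
  then obtain n where n: "n = m \<or> n = Suc m" and "D n \<noteq> 0"
    by blast
  then have D: "1 \<le> \<bar>real_of_int (D n)\<bar>"
    by linarith
  have B: "real_of_int (B n) > 0" "real_of_int (B (Suc n)) > 0" "real_of_int N > 0"
    using B_pos N by (auto simp del: gcf_denom.simps)
  have "2 * N * P (Suc n) \<le> B (Suc n)"
    using n by (intro small) auto
  then have "real_of_int (2 * N * P (Suc n)) \<le> real_of_int (B (Suc n))"
    by (simp only: of_int_le_iff)
  then have half: "N * B n * gap n \<le> 1 / 2"
    using B by (simp add: gap_def field_simps del: gcf_denom.simps)
  have "real_of_int (D n) = N * B n * ((gcf_convergent a b n - \<tau>) + (\<tau> - M / N))"
    using B unfolding D_def gcf_convergent_def by (simp add: field_simps)
  also have "\<bar>\<dots>\<bar> = N * B n * \<bar>(gcf_convergent a b n - \<tau>) + (\<tau> - M / N)\<bar>"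
    using B by (simp add: abs_mult)
  also have "\<dots> \<le> N * B n * (gap n + \<bar>\<tau> - M / N\<bar>)"
    using B convergent_error[OF lim, of n] unfolding \<tau>_def
    by (intro mult_left_mono) auto
  finally have "1 / 2 \<le> N * B n * \<bar>\<tau> - M / N\<bar>"
    using D half by (simp add: distrib_left)
  also have "\<dots> \<le> N * B (Suc m) * \<bar>\<tau> - M / N\<bar>"
  proof -
    have "B n \<le> B (Suc m)"
      using n B_le_Suc[of m] by auto
    with B show ?thesis
      by (intro mult_right_mono mult_left_mono) auto
  qed
  finally show ?thesis
    using B B_pos[of "Suc m"] unfolding \<tau>_def
    by (simp add: field_simps del: gcf_denom.simps)
qed

end

section \<open>Irrationality exponents\<close>

text \<open>A rational \<open>p / q\<close> equals \<open>kp / kq\<close> with arbitrarily large denominators \<open>kq\<close>, and the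
  distance \<open>0\<close> violates every lower bound.\<close>

lemma irrationality_exponent_imp_irrational:
  assumes "irrationality_exponent \<tau> \<mu>"
  shows "\<tau> \<notin> \<rat>"
proof
  assume "\<tau> \<in> \<rat>"
  then obtain p q :: int where q: "q > 0" and \<tau>: "\<tau> = p / q"
    by (metis Rats_cases' of_int_0_less_iff)
  obtain c N\<^sub>0 where c: "c > 0" "N\<^sub>0 > 0" and
    bound: "\<And>M N :: int. N\<^sub>0 \<le> N \<Longrightarrow>
      c / N powr \<mu> \<le> \<bar>\<tau> - real_of_int M / N\<bar>"
    using assms unfolding irrationality_exponent_def by metis
  define k where "k = \<lceil>N\<^sub>0\<rceil>"
  have k: "k > 0" "N\<^sub>0 \<le> k"
    using c by (auto simp: k_def)
  have "k * 1 \<le> k * q"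
    using q k by (intro mult_left_mono) auto
  then have "N\<^sub>0 \<le> real_of_int (k * q)"
    using k(2) by linarith
  from bound[OF this, of "k * p"] have "c / real_of_int (k * q) powr \<mu> \<le> 0"
    using q k \<tau> by simp
  moreover have "0 < c / real_of_int (k * q) powr \<mu>"
    using c q k by simp
  ultimately show False
    by simp
qed

section \<open>Entries with polynomial bounds\<close>

text \<open>The excess \<open>\<epsilon>\<close> pays for the factors that are polynomial or exponential in the index \<open>m\<close>
  of the convergent used: \<open>N\<close> is, up to such factors, at least \<open>(m!)^(k\<^sub>1-l)\<close>, and any
  positive power of \<open>m!\<close> dominates them.\<close>

theorem gcf_irrationality_exponent:
  fixes a b :: "nat \<Rightarrow> int" and \<alpha> l \<beta>\<^sub>1 \<beta>\<^sub>2 k\<^sub>1 k\<^sub>2 \<epsilon> :: real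
  assumes "positive_gcf a b"
    and a_le: "\<And>n. n \<ge> 1 \<Longrightarrow> real_of_int (a n) \<le> \<alpha> * real n powr l"
    and b_ge: "\<And>n. n \<ge> 1 \<Longrightarrow> \<beta>\<^sub>1 * real n powr k\<^sub>1 \<le> real_of_int (b n)"
    and b_le: "\<And>n. n \<ge> 1 \<Longrightarrow> real_of_int (b n) \<le> \<beta>\<^sub>2 * real n powr k\<^sub>2"
    and "0 \<le> l" "l < k\<^sub>1" "k\<^sub>1 \<le> k\<^sub>2" "0 < \<beta>\<^sub>1" "0 < \<beta>\<^sub>2"
  shows gcf_tendsto_value: "gcf_convergent a b \<longlonglongrightarrow> gcf_value a b"
    and "0 < \<epsilon> \<Longrightarrow> irrationality_exponent (gcf_value a b) (2 + l / (k\<^sub>1 - l) + \<epsilon>)"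
proof -
  interpret positive_gcf a b by fact
  define s where "s = k\<^sub>1 - l"
  define \<theta> where "\<theta> = l / s"
  \<comment> \<open>The exponential loss when \<open>P n / B n\<close> is compared with \<open>1 / fact n powr s\<close>.\<close>
  define q where "q = \<alpha> / \<beta>\<^sub>1"
  have s: "s > 0" "\<theta> \<ge> 0" "s * \<theta> = l"
    using assms by (auto simp: s_def \<theta>_def)
  have \<alpha>: "\<alpha> \<ge> 1"
    using a_le[of 1] a_pos[of 1] by simp
  have q: "q > 0"
    using \<alpha> assms by (simp add: q_def)
  have P_le: "real_of_int (P n) \<le> \<alpha> ^ n * fact n powr l" for n
  proof -
    have "real_of_int (P n) = (\<Prod>i=1..n. real_of_int (a i))"
      by (simp add: P_def)
    also have "\<dots> \<le> (\<Prod>i=1..n. \<alpha> * real i powr l)"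
      using a_le a_pos by (intro prod_mono) (auto simp: less_imp_le)
    finally show ?thesis
      unfolding prod_powr_nat .
  qed
  have B_ge: "\<beta>\<^sub>1 ^ n * fact n powr k\<^sub>1 \<le> real_of_int (B n)" for n
  proof -
    have "(\<Prod>i=1..n. \<beta>\<^sub>1 * real i powr k\<^sub>1) \<le> (\<Prod>i=1..n. real_of_int (b i))"
      using b_ge assms by (intro prod_mono) auto
    also have "\<dots> = real_of_int (\<Prod>i=1..n. b i)"
      by simp
    also have "\<dots> \<le> B n"
      using B_ge_prod[of n] by (simp only: of_int_le_iff)
    finally show ?thesis
      unfolding prod_powr_nat .
  qed
  have ratio: "P n * fact n powr s \<le> q ^ n * B n" for n
  proof -
    have "P n * fact n powr s \<le> \<alpha> ^ n * fact n powr l * fact n powr s"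
      by (intro mult_right_mono P_le) auto
    also have "\<dots> = q ^ n * (\<beta>\<^sub>1 ^ n * fact n powr k\<^sub>1)"
      using assms by (simp add: q_def s_def power_divide flip: powr_add)
    also have "\<dots> \<le> q ^ n * B n"
      using q by (intro mult_left_mono B_ge) auto
    finally show ?thesis .
  qed
  have lim: "(\<lambda>n. real_of_int (P n) / B n) \<longlonglongrightarrow> 0"
  proof -
    obtain C where C: "C > 0" "\<And>n. (2 * q) ^ n \<le> C * fact n powr s"
      using power_le_factorial_powr[of "2 * q" s] q s by auto
    have le: "P n / B n \<le> C * (1 / 2) ^ n" for n
    proof -
      have "P n * (2 * q) ^ n \<le> P n * (C * fact n powr s)"
        using P_pos[of n] by (intro mult_left_mono C) simp
      also have "\<dots> \<le> C * (q ^ n * B n)"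
        using ratio[of n] C(1) by (simp add: mult.left_commute)
      finally have "P n * 2 ^ n \<le> C * B n"
        using q by (simp add: power_mult_distrib mult.left_commute)
      then show ?thesis
        using B_pos[of n] by (simp add: field_simps power_one_over del: gcf_denom.simps)
    qed
    have norm_le: "norm (real_of_int (P n) / B n) \<le> C * (1 / 2) ^ n" for n
      using le[of n] P_pos[of n] B_pos[of n] by simp
    have "(\<lambda>n. C * (1 / 2) ^ n) \<longlonglongrightarrow> C * 0"
      by (intro tendsto_mult_left LIMSEQ_power_zero) simp
    then have "(\<lambda>n. C * (1 / 2) ^ n) \<longlonglongrightarrow> 0"
      by simp
    with norm_le show ?thesis
      by (rule Lim_null_comparison[OF always_eventually[OF allI]])
  qed
  show "gcf_convergent a b \<longlonglongrightarrow> gcf_value a b"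
    using lim by (rule convergents_tendsto)

  show "irrationality_exponent (gcf_value a b) (2 + l / (k\<^sub>1 - l) + \<epsilon>)" if \<epsilon>: "0 < \<epsilon>"
  proof -
    \<comment> \<open>The base of all exponential factors: those of \<open>P m\<close>, and \<open>q powr \<epsilon>\<close> from rewriting
      \<open>fact m powr (s * \<epsilon>)\<close> as a power of \<open>N\<close>.\<close>
    define G where "G = \<alpha> * q powr \<theta> * q powr \<epsilon>"
    obtain C where C: "C > 0"
      "\<And>n. (real n + 1) powr k\<^sub>2 * G ^ n \<le> C * fact n powr (s * \<epsilon>)"
      using poly_times_power_le_factorial_powr[of G "s * \<epsilon>" k\<^sub>2] \<alpha> q s \<epsilon> assms
      by (auto simp: G_def)
    define E where "E = (\<alpha> + \<beta>\<^sub>2) * C * 2 powr (1 + \<theta> + \<epsilon>)"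
    have E: "E > 0"
      using \<alpha> C assms by (simp add: E_def add_pos_pos)
    have "1 / (2 * E) / N powr (2 + \<theta> + \<epsilon>) \<le> \<bar>gcf_value a b - M / N\<bar>"
      if N: "1 \<le> real_of_int N" for M N :: int
    proof -
      have N1: "N \<ge> 1" using N by simp
      \<comment> \<open>The set is finite because \<open>P n / B n\<close> tends to \<open>0\<close>, and contains \<open>0\<close> because
        \<open>P 0 = B 0 = 1\<close>; so it has a last element.\<close>
      define T where "T = {n. B n < 2 * N * P n}"
      have "eventually (\<lambda>n. real_of_int (P n) / B n < 1 / (2 * N)) sequentially"
        using lim N by (intro order_tendstoD(2)[OF lim]) auto
      then obtain n\<^sub>0 where n\<^sub>0: "\<And>n. n \<ge> n\<^sub>0 \<Longrightarrow> real_of_int (P n) / B n < 1 / (2 * N)"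
        unfolding eventually_sequentially by blast
      have "n < n\<^sub>0" if "n \<in> T" for n
      proof (rule ccontr)
        assume "\<not> n < n\<^sub>0"
        then have "real_of_int (2 * N * P n) < B n"
          using n\<^sub>0[of n] N B_pos[of n] by (simp add: field_simps)
        then have "2 * N * P n < B n"
          by (simp only: of_int_less_iff)
        with that show False by (simp add: T_def)
      qed
      then have fin: "finite T"
        by (metis bounded_nat_set_is_finite)
      have "0 \<in> T"
        using N1 by (simp add: T_def)
      define m where "m = Max T"
      have m: "m \<in> T"
        unfolding m_def using fin \<open>0 \<in> T\<close> by (intro Max_in) auto
      have after_m: "2 * N * P n \<le> B n" if "n > m" for n
        using Max_ge[OF fin, of n] that by (force simp: m_def T_def)
      have dist: "1 / (2 * real_of_int N * B (Suc m)) \<le> \<bar>gcf_value a b - M / N\<bar>"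
        using after_m by (rule rational_distance_ge[OF lim N1])
      have "B m < 2 * N * P m"
        using m by (simp add: T_def)
      then have Bm: "real_of_int (B m) < 2 * N * real_of_int (P m)"
        by (metis of_int_less_iff of_int_mult of_int_numeral)
      \<comment> \<open>Up to an exponential factor, this converts factorials of \<open>m\<close> into powers of \<open>N\<close>.\<close>
      have F: "fact m powr s \<le> q ^ m * (2 * N)"
      proof -
        have "P m * fact m powr s \<le> q ^ m * B m"
          by (rule ratio)
        also have "\<dots> \<le> q ^ m * (2 * N * P m)"
          using q Bm by (intro mult_left_mono) auto
        finally have "P m * fact m powr s \<le> P m * (q ^ m * (2 * N))"
          by (simp add: mult_ac)
        then show ?thesis
          using P_pos[of m] by simp
      qed
      have Fe: "fact m powr (s * e) \<le> (q powr e) ^ m * (2 * N) powr e" if "e \<ge> 0" for e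
      proof -
        have "(fact m powr s) powr e \<le> (q ^ m * (2 * N)) powr e"
          using F that by (intro powr_mono2) auto
        also have "\<dots> = (q powr e) ^ m * (2 * N) powr e"
          using q N by (simp add: powr_mult powr_powr mult.commute flip: powr_realpow)
        finally show ?thesis by (simp add: powr_powr)
      qed
      \<comment> \<open>The bound on \<open>a\<close> is weakened to the exponent of the bound on \<open>b\<close>, as \<open>l < k\<^sub>2\<close>.\<close>
      have ab: "real_of_int (a (Suc m) + b (Suc m)) \<le> (\<alpha> + \<beta>\<^sub>2) * (real m + 1) powr k\<^sub>2"
      proof -
        have "real (Suc m) powr l \<le> real (Suc m) powr k\<^sub>2"
          using assms by (intro powr_mono) auto
        then have "\<alpha> * real (Suc m) powr l \<le> \<alpha> * real (Suc m) powr k\<^sub>2"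
          using \<alpha> by (intro mult_left_mono) auto
        then show ?thesis
          using a_le[of "Suc m"] b_le[of "Suc m"] by (simp add: distrib_right add.commute)
      qed
      have "P m \<le> \<alpha> ^ m * fact m powr (s * \<theta>)"
        using P_le s by simp
      also have "\<dots> \<le> \<alpha> ^ m * ((q powr \<theta>) ^ m * (2 * N) powr \<theta>)"
        using \<alpha> s by (intro mult_left_mono Fe) auto
      finally have Pm: "P m \<le> \<alpha> ^ m * (q powr \<theta>) ^ m * (2 * N) powr \<theta>"
        by (simp add: mult.assoc)
      have poly: "(real m + 1) powr k\<^sub>2 * (\<alpha> ^ m * (q powr \<theta>) ^ m) \<le> C * (2 * N) powr \<epsilon>"
      proof -
        have "(q powr \<epsilon>) ^ m * ((real m + 1) powr k\<^sub>2 * (\<alpha> ^ m * (q powr \<theta>) ^ m))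
            = (real m + 1) powr k\<^sub>2 * G ^ m"
          by (simp add: G_def power_mult_distrib)
        also have "\<dots> \<le> C * fact m powr (s * \<epsilon>)"
          by (rule C)
        also have "\<dots> \<le> C * ((q powr \<epsilon>) ^ m * (2 * N) powr \<epsilon>)"
          using C \<epsilon> by (intro mult_left_mono Fe) auto
        finally have "(q powr \<epsilon>) ^ m * ((real m + 1) powr k\<^sub>2 * (\<alpha> ^ m * (q powr \<theta>) ^ m))
            \<le> (q powr \<epsilon>) ^ m * (C * (2 * N) powr \<epsilon>)"
          by (simp add: mult_ac)
        then show ?thesis
          using q by (subst (asm) mult_le_cancel_left_pos) auto
      qed
      have "real_of_int (B (Suc m)) \<le> real_of_int (a (Suc m) + b (Suc m)) * B m"
        using B_Suc_le[of m] by (metis of_int_le_iff of_int_mult)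
      also have "\<dots> \<le> ((\<alpha> + \<beta>\<^sub>2) * (real m + 1) powr k\<^sub>2) * (2 * N * P m)"
        using ab Bm B_pos[of m] \<alpha> assms by (intro mult_mono) auto
      also have "\<dots> \<le> ((\<alpha> + \<beta>\<^sub>2) * (real m + 1) powr k\<^sub>2) *
          (2 * N * (\<alpha> ^ m * (q powr \<theta>) ^ m * (2 * N) powr \<theta>))"
        using Pm \<alpha> assms N by (intro mult_left_mono) auto
      also have "\<dots> = (\<alpha> + \<beta>\<^sub>2) * (2 * N) * (2 * N) powr \<theta> *
          ((real m + 1) powr k\<^sub>2 * (\<alpha> ^ m * (q powr \<theta>) ^ m))"
        by (simp add: mult_ac)
      also have "\<dots> \<le> (\<alpha> + \<beta>\<^sub>2) * (2 * N) * (2 * N) powr \<theta> * (C * (2 * N) powr \<epsilon>)"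
        using poly \<alpha> assms N by (intro mult_left_mono) auto
      also have "\<dots> = (\<alpha> + \<beta>\<^sub>2) * C * (2 * real_of_int N) powr (1 + \<theta> + \<epsilon>)"
        using N by (simp add: powr_add)
      also have "\<dots> = E * N powr (1 + \<theta> + \<epsilon>)"
        using N by (simp add: E_def powr_mult)
      finally have "2 * real_of_int N * B (Suc m) \<le> 2 * real_of_int N * (E * N powr (1 + \<theta> + \<epsilon>))"
        using N by (intro mult_left_mono) auto
      also have "\<dots> = 2 * E * N powr (2 + \<theta> + \<epsilon>)"
      proof -
        have "real_of_int N powr (2 + \<theta> + \<epsilon>) = N * N powr (1 + \<theta> + \<epsilon>)"
          using N powr_add[of N 1 "1 + \<theta> + \<epsilon>"] by (simp add: add.assoc)
        then show ?thesis by simp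
      qed
      finally have "1 / (2 * E * N powr (2 + \<theta> + \<epsilon>)) \<le> 1 / (2 * real_of_int N * B (Suc m))"
        using N B_pos[of "Suc m"] by (intro divide_left_mono) (auto simp del: gcf_denom.simps intro!: mult_pos_pos E)
      with dist show ?thesis
        by simp
    qed
    then show ?thesis
      unfolding irrationality_exponent_def using E
      by (intro exI[of _ "1 / (2 * E)"] conjI exI[of _ 1]) (auto simp: \<theta>_def s_def)
  qed
qed

theorem theorem4p1:
  fixes a b :: "nat \<Rightarrow> int"
    and \<tau> \<alpha> l \<beta>\<^sub>1 \<beta>\<^sub>2 k\<^sub>1 k\<^sub>2 :: real
  assumes a_pos: "\<And>n. n \<ge> 1 \<Longrightarrow> a n > 0"
    and b_pos: "\<And>n. n \<ge> 1 \<Longrightarrow> b n > 0"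
    and tau: "\<tau> = gcf_value a b"
    and a_le: "\<And>n. n \<ge> 1 \<Longrightarrow> real_of_int (a n) \<le> \<alpha> * real n powr l"
    and b_ge: "\<And>n. n \<ge> 1 \<Longrightarrow> \<beta>\<^sub>1 * real n powr k\<^sub>1 \<le> real_of_int (b n)"
    and b_le: "\<And>n. n \<ge> 1 \<Longrightarrow> real_of_int (b n) \<le> \<beta>\<^sub>2 * real n powr k\<^sub>2"
    and l_nonneg: "l \<ge> 0"
    and pos: "\<beta>\<^sub>1 > 0" "\<beta>\<^sub>2 > 0" "k\<^sub>1 > 0" "k\<^sub>2 > 0"
    and l_less: "l < k\<^sub>1"
    and k_le: "k\<^sub>1 \<le> k\<^sub>2"
  shows "gcf_convergent a b \<longlonglongrightarrow> \<tau>
         \<and> \<tau> \<notin> \<rat>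
         \<and> asymp_irrationality_exponent \<tau> \<le> ereal (2 + l / (k\<^sub>1 - l))"
proof -
  have gcf: "positive_gcf a b"
    using a_pos b_pos by unfold_locales auto
  note main = gcf_irrationality_exponent[OF gcf a_le b_ge b_le l_nonneg l_less k_le pos(1,2)]
  have lim: "gcf_convergent a b \<longlonglongrightarrow> \<tau>"
    using main(1) tau by simp
  have exponent: "irrationality_exponent \<tau> (2 + l / (k\<^sub>1 - l) + \<epsilon>)" if "\<epsilon> > 0" for \<epsilon>
    using main(2) that tau by simp
  have "asymp_irrationality_exponent \<tau> \<le> ereal (2 + l / (k\<^sub>1 - l))"
  proof (rule ereal_le_epsilon2)
    fix \<epsilon> :: real assume "0 < \<epsilon>"
    then have "asymp_irrationality_exponent \<tau> \<le> ereal (2 + l / (k\<^sub>1 - l) + \<epsilon>)"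
      unfolding asymp_irrationality_exponent_def by (intro Inf_lower) (use exponent in auto)
    then show "asymp_irrationality_exponent \<tau> \<le> ereal (2 + l / (k\<^sub>1 - l)) + ereal \<epsilon>"
      by simp
  qed
  then show ?thesis
    using lim irrationality_exponent_imp_irrational[OF exponent[of 1]] by simp
qed

end
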